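(* Let $n\ge2$, $\gamma\in[0,1)$, and let $\Omega$ be a bounded convex domain of $\mathbb{R}^n$ that satisfies an interior ball condition. Let $u\in C^2(\Omega)\cap C(\overline\Omega)$ be a solution to $$\Delta u+u^\gamma-u^{\frac{1+\gamma}{2}}g(u)=0\ \text{ in }\Omega,\qquad u=0\ \text{ on }\partial\Omega,\qquad u>0\ \text{ in }\Omega.$$ Set $m:=\|u\|_{L^\infty(\Omega)}$ and assume that $g\in C^1((0,m],\mathbb{R}^+)$ satisfies $$g(s)\le s^{\frac{\gamma-1}{2}},\qquad g'(s)\ge0\qquad\text{for }s\in(0,m],$$ and that for some $\delta\ge0$ $$\mathcal{HC}_h(s_1,s_3,\lambda)\le\delta\qquad\text{for all }s_1,s_3\in\big(0,m^{\frac{1-\gamma}{2}}\big],\ \lambda\in[0,1],\qquad\text{where }h(s)=g\big(s^{\frac{2}{1-\gamma}}\big).$$ Then there exist a concave function $v:\Omega\to\mathbb{R}$ and a positive constant $C=C(n,m,\gamma)$ such that $$\|u^{(1-\gamma)/2}-v\|_{L^\infty(\Omega)}\le C\delta.$$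
   Context: $\mathbb{R}^+=(0,\infty)$. A domain is a connected open set. For a positive function $h$ on an interval, the harmonic convexity function is $$\mathcal{HC}_h(s_1,s_3,\lambda):=h(\lambda s_1+(1-\lambda)s_3)-\frac{h(s_1)h(s_3)}{(1-\lambda)h(s_1)+\lambda h(s_3)}.$$ The notation $C=C(n,m,\gamma)$ means that the constant depends only on $n,m,\gamma$. *)

theory Defs
  imports "HOL-Analysis.Analysis" "HOL-Probability.Essential_Supremum"
begin

text \<open>Partial derivatives at a point of an open set \<open>\<Omega>\<close> only depend on the values on \<open>\<Omega>\<close>,
  so the behaviour of a total function outside \<open>\<Omega>\<close> plays no role below.\<close>

definition partial_deriv :: "'n::finite \<Rightarrow> (real ^ 'n \<Rightarrow> real) \<Rightarrow> real ^ 'n \<Rightarrow> real" where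
  "partial_deriv i f x = deriv (\<lambda>t. f (x + t *\<^sub>R axis i 1)) 0"

definition C1_on :: "(real ^ 'n::finite) set \<Rightarrow> (real ^ 'n \<Rightarrow> real) \<Rightarrow> bool" where
  "C1_on \<Omega> f \<longleftrightarrow>
     (\<forall>i. (\<forall>x\<in>\<Omega>. (\<lambda>t. f (x + t *\<^sub>R axis i 1)) field_differentiable at 0) \<and>
          continuous_on \<Omega> (partial_deriv i f))"

definition C2_on :: "(real ^ 'n::finite) set \<Rightarrow> (real ^ 'n \<Rightarrow> real) \<Rightarrow> bool" where
  "C2_on \<Omega> f \<longleftrightarrow> C1_on \<Omega> f \<and> (\<forall>i. C1_on \<Omega> (partial_deriv i f))"

definition laplacian :: "(real ^ 'n::finite \<Rightarrow> real) \<Rightarrow> real ^ 'n \<Rightarrow> real" where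
  "laplacian f x = (\<Sum>i\<in>UNIV. partial_deriv i (partial_deriv i f) x)"

definition interior_ball_condition :: "'a::euclidean_space set \<Rightarrow> bool" where
  "interior_ball_condition \<Omega> \<longleftrightarrow>
     (\<forall>x\<in>frontier \<Omega>. \<exists>y r. r > 0 \<and> ball y r \<subseteq> \<Omega> \<and> x \<in> sphere y r)"

text \<open>The value is \<open>\<infinity>\<close> if \<open>\<bar>f\<bar>\<close> is not Lebesgue measurable on \<open>\<Omega>\<close>, and \<open>-\<infinity>\<close> if \<open>\<Omega>\<close> is a null
  set; the latter does not happen for nonempty open \<open>\<Omega>\<close>.\<close>

definition Linfty_norm :: "'a::euclidean_space set \<Rightarrow> ('a \<Rightarrow> real) \<Rightarrow> ereal" where
  "Linfty_norm \<Omega> f = esssup (lebesgue_on \<Omega>) (\<lambda>x. ereal \<bar>f x\<bar>)"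

definition HC :: "(real \<Rightarrow> real) \<Rightarrow> real \<Rightarrow> real \<Rightarrow> real \<Rightarrow> real" where
  "HC h s\<^sub>1 s\<^sub>3 l =
     h (l * s\<^sub>1 + (1 - l) * s\<^sub>3) - h s\<^sub>1 * h s\<^sub>3 / ((1 - l) * h s\<^sub>1 + l * h s\<^sub>3)"

end

theory Submission
  imports Defs
begin

text \<open>Put k = (1 - \<gamma>) / 2 and w = u powr k. The function w solves
  \<Delta>w = k (h(w) - (1 + c |\<nabla>w|^2) / w) with c = (1 - k) / k^2 and h(s) = g(s powr (1 / k))
(lemma \<open>power_transform_equation\<close>). The right-hand side is increasing in w, and 1 / w is harmonic
linear: the weighted harmonic mean of 1 / a and 1 / b is the reciprocal of the weighted mean of a
and b. By hypothesis h is harmonic concave up to \<delta>.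

The proof is a quantitative version of the concavity maximum principle of Korevaar, Kennedy and
Kawohl. Consider the convexity gap l w(x) + (1 - l) w(y) - w(l x + (1 - l) y) on pairs of points of
the closed domain. At an interior maximum the gradients at the three points agree, and the second-order
test, with endpoints moving at different speeds, compares the Laplacian at the intermediate point
with those at the endpoints; it yields a gap of at most M^2 \<delta>, where M = m powr k bounds w
(lemma \<open>interior_max_gap_le\<close>). A positive maximum cannot involve a boundary point: u is
superharmonic, so the interior ball condition gives linear growth of u at the boundary
(\<open>superharmonic_linear_boundary_growth\<close>) and hence infinite slope of w, and moving a
boundary point inward increases the gap (\<open>gap_increases_from_boundary\<close>).

Thus w satisfies the concavity inequality up to the error M^2 \<delta> (\<open>gap_estimate\<close>). By
Caratheodory's theorem its concave envelope v then differs from w by at most a dimensional multiple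
of this error (\<open>approx_concave_near_concave\<close>).\<close>

section \<open>Second-order expansions on lines\<close>

text \<open>The pair (a, b) consists of the first and second derivative of f at 0. Twice differentiability at the
single point 0 suffices for second-order tests, and it is what a C2 function provides on each line
parallel to a coordinate axis. Working only on such lines avoids Frechet derivatives and Hessians:
all that is needed from the second derivatives is their sum, the Laplacian.\<close>

definition has_second_order_at0 :: "(real \<Rightarrow> real) \<Rightarrow> real \<Rightarrow> real \<Rightarrow> bool" where
  "has_second_order_at0 f a b \<longleftrightarrow>
     (\<exists>f'. (\<forall>\<^sub>F t in nhds 0. (f has_real_derivative f' t) (at t)) \<and> f' 0 = a \<and>
           (f' has_real_derivative b) (at 0))"

lemma has_second_order_at0_D:
  assumes "has_second_order_at0 f a b"
  shows "(f has_real_derivative a) (at 0)"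
  using assms eventually_nhds_x_imp_x unfolding has_second_order_at0_def by blast

lemma has_second_order_at0_cmult:
  assumes "has_second_order_at0 f a b"
  shows "has_second_order_at0 (\<lambda>t. c * f t) (c * a) (c * b)"
proof -
  obtain f' where f': "\<forall>\<^sub>F t in nhds 0. (f has_real_derivative f' t) (at t)" "f' 0 = a"
    "(f' has_real_derivative b) (at 0)"
    using assms unfolding has_second_order_at0_def by auto
  show ?thesis
    unfolding has_second_order_at0_def
  proof (intro exI[of _ "\<lambda>t. c * f' t"] conjI)
    show "\<forall>\<^sub>F t in nhds 0. ((\<lambda>t. c * f t) has_real_derivative c * f' t) (at t)"
      using f'(1) by eventually_elim (auto intro!: DERIV_cmult)
  qed (use f' in \<open>auto intro!: DERIV_cmult\<close>)
qed

lemma has_second_order_at0_add: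
  assumes "has_second_order_at0 f a b" "has_second_order_at0 g c d"
  shows "has_second_order_at0 (\<lambda>t. f t + g t) (a + c) (b + d)"
proof -
  obtain f' where f': "\<forall>\<^sub>F t in nhds 0. (f has_real_derivative f' t) (at t)" "f' 0 = a"
    "(f' has_real_derivative b) (at 0)"
    using assms(1) unfolding has_second_order_at0_def by auto
  obtain g' where g': "\<forall>\<^sub>F t in nhds 0. (g has_real_derivative g' t) (at t)" "g' 0 = c"
    "(g' has_real_derivative d) (at 0)"
    using assms(2) unfolding has_second_order_at0_def by auto
  show ?thesis
    unfolding has_second_order_at0_def
  proof (intro exI[of _ "\<lambda>t. f' t + g' t"] conjI)
    show "\<forall>\<^sub>F t in nhds 0. ((\<lambda>t. f t + g t) has_real_derivative f' t + g' t) (at t)"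
      using f'(1) g'(1) by eventually_elim (auto intro!: DERIV_add)
  qed (use f' g' in \<open>auto intro!: DERIV_add\<close>)
qed

lemma has_second_order_at0_rescale:
  assumes "has_second_order_at0 f a b"
  shows "has_second_order_at0 (\<lambda>t. f (c * t)) (c * a) (c\<^sup>2 * b)"
proof -
  obtain f' where f': "\<forall>\<^sub>F t in nhds 0. (f has_real_derivative f' t) (at t)" "f' 0 = a"
    "(f' has_real_derivative b) (at 0)"
    using assms unfolding has_second_order_at0_def by auto
  have lim: "filterlim (\<lambda>t::real. c * t) (nhds 0) (nhds 0)"
    using tendsto_mult_left[OF tendsto_ident_at, of c 0 UNIV]
    by (simp add: tendsto_nhds_iff)
  have scale: "((\<lambda>t. c * t) has_real_derivative c) (at t)" for t :: real
    by (auto intro!: derivative_eq_intros)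
  show ?thesis
    unfolding has_second_order_at0_def
  proof (intro exI[of _ "\<lambda>t. c * f' (c * t)"] conjI)
    have "\<forall>\<^sub>F t in nhds 0. (f has_real_derivative f' (c * t)) (at (c * t))"
      using f'(1) lim by (rule eventually_compose_filterlim)
    then show "\<forall>\<^sub>F t in nhds 0. ((\<lambda>t. f (c * t)) has_real_derivative c * f' (c * t)) (at t)"
    proof eventually_elim
      case (elim t)
      show ?case using DERIV_chain2[OF elim scale] by (simp add: mult.commute)
    qed
    have "((\<lambda>t. f' (c * t)) has_real_derivative b * c) (at 0)"
      by (rule DERIV_chain2[OF _ scale]) (use f'(3) in simp)
    from DERIV_cmult[OF this, of c]
    show "((\<lambda>t. c * f' (c * t)) has_real_derivative c\<^sup>2 * b) (at 0)"
      by (simp add: power2_eq_square algebra_simps)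
  qed (use f' in auto)
qed

lemma has_second_order_at0_powr:
  assumes "has_second_order_at0 f a b" and pos: "f 0 > 0"
  shows "has_second_order_at0 (\<lambda>t. f t powr k) (k * f 0 powr (k - 1) * a)
           (k * (k - 1) * f 0 powr (k - 2) * a\<^sup>2 + k * f 0 powr (k - 1) * b)"
proof -
  obtain f' where f': "\<forall>\<^sub>F t in nhds 0. (f has_real_derivative f' t) (at t)" "f' 0 = a"
    "(f' has_real_derivative b) (at 0)"
    using assms unfolding has_second_order_at0_def by auto
  have der0: "(f has_real_derivative a) (at 0)"
    using assms(1) by (rule has_second_order_at0_D)
  have "isCont f 0" using der0 by (rule DERIV_isCont)
  then have "\<forall>\<^sub>F t in nhds 0. f t > 0"
    using pos by (simp add: isCont_def tendsto_nhds_iff order_tendstoD(1))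
  show ?thesis
    unfolding has_second_order_at0_def
  proof (intro exI[of _ "\<lambda>t. k * f t powr (k - 1) * f' t"] conjI)
    show "\<forall>\<^sub>F t in nhds 0. ((\<lambda>t. f t powr k) has_real_derivative k * f t powr (k - 1) * f' t) (at t)"
      using f'(1) \<open>\<forall>\<^sub>F t in nhds 0. f t > 0\<close>
    proof eventually_elim
      case (elim t)
      show ?case using DERIV_fun_powr[OF elim(1,2), of k] by simp
    qed
    have "((\<lambda>t. f t powr (k - 1)) has_real_derivative (k - 1) * f 0 powr (k - 2) * a) (at 0)"
      using DERIV_fun_powr[OF der0 pos, of "k - 1"] by (simp add: algebra_simps)
    from DERIV_mult[OF DERIV_cmult[OF this, of k] f'(3)]
    show "((\<lambda>t. k * f t powr (k - 1) * f' t) has_real_derivative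
      k * (k - 1) * f 0 powr (k - 2) * a\<^sup>2 + k * f 0 powr (k - 1) * b) (at 0)"
      by (simp add: f'(2) power2_eq_square algebra_simps)
  qed (use f' in auto)
qed

text \<open>The first derivative vanishes at a local maximum, so a positive second derivative would make
it positive, and f increasing, just to the right of 0.\<close>

lemma has_second_order_at0_local_max:
  assumes f: "has_second_order_at0 f a b" and max: "\<forall>\<^sub>F t in nhds 0. f t \<le> f 0"
  shows "b \<le> 0"
proof (rule ccontr)
  assume "\<not> b \<le> 0"
  then have b: "b > 0" by simp
  obtain f' where f': "\<forall>\<^sub>F t in nhds 0. (f has_real_derivative f' t) (at t)" "f' 0 = a"
    "(f' has_real_derivative b) (at 0)"
    using f unfolding has_second_order_at0_def by auto
  obtain e1 where e1: "e1 > 0" "\<And>t. \<bar>t\<bar> < e1 \<Longrightarrow> f t \<le> f 0 \<and> (f has_real_derivative f' t) (at t)"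
    using eventually_conj[OF max f'(1)] unfolding eventually_nhds_metric by (auto simp: dist_real_def)
  have a0: "a = 0"
    by (rule DERIV_local_max[OF has_second_order_at0_D[OF f] e1(1)]) (use e1 in auto)
  obtain e2 where e2: "e2 > 0" "\<And>t. 0 < t \<Longrightarrow> t < e2 \<Longrightarrow> f' 0 < f' t"
    using DERIV_pos_inc_right[OF f'(3) b] by auto
  define t where "t = min e1 e2 / 2"
  have t: "0 < t" "t < e1" "t < e2" using e1(1) e2(1) by (auto simp: t_def min_def)
  have "f 0 < f t"
  proof (rule DERIV_pos_imp_increasing_open[OF t(1)])
    fix s assume s: "0 < s" "s < t"
    have "f' 0 < f' s" using e2(2)[of s] s t by auto
    moreover have "(f has_real_derivative f' s) (at s)" using e1(2)[of s] s t by auto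
    ultimately show "\<exists>y. (f has_real_derivative y) (at s) \<and> 0 < y"
      using f'(2) a0 by auto
  next
    show "continuous_on {0..t} f"
    proof (intro continuous_at_imp_continuous_on ballI)
      fix s assume "s \<in> {0..t}"
      then show "isCont f s" using e1(2)[of s] t by (auto intro: DERIV_isCont)
    qed
  qed
  with e1(2)[of t] t show False by auto
qed

lemma has_real_derivative_local_max_0:
  fixes f :: "real \<Rightarrow> real"
  assumes "(f has_real_derivative a) (at 0)" "\<forall>\<^sub>F t in nhds 0. f t \<le> f 0"
  shows "a = 0"
proof -
  obtain e where e: "e > 0" "\<And>t. \<bar>t\<bar> < e \<Longrightarrow> f t \<le> f 0"
    using assms(2) unfolding eventually_nhds_metric by (auto simp: dist_real_def)
  show ?thesis by (rule DERIV_local_max[OF assms(1) e(1)]) (use e in auto)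
qed

section \<open>Restriction of C2 functions to coordinate lines\<close>

lemma eventually_line_in_open:
  fixes x d :: "'a::real_normed_vector"
  assumes "open S" "x \<in> S"
  shows "\<forall>\<^sub>F t in nhds (0::real). x + t *\<^sub>R d \<in> S"
proof -
  have "continuous_on UNIV (\<lambda>t::real. x + t *\<^sub>R d)" by (intro continuous_intros)
  then have "open ((\<lambda>t::real. x + t *\<^sub>R d) -` S)" using assms(1) by (simp add: open_vimage)
  moreover have "0 \<in> (\<lambda>t::real. x + t *\<^sub>R d) -` S" using assms(2) by simp
  ultimately show ?thesis unfolding eventually_nhds by blast
qed

lemma C1_on_has_partial_deriv:
  assumes "C1_on S f" "x \<in> S"
  shows "((\<lambda>t. f (x + t *\<^sub>R axis i 1)) has_real_derivative partial_deriv i f x) (at 0)"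
  using assms unfolding C1_on_def partial_deriv_def by (simp add: field_differentiable_derivI)

lemma C1_on_has_partial_deriv_shifted:
  assumes "C1_on S f" "x + s *\<^sub>R axis i 1 \<in> S"
  shows "((\<lambda>t. f (x + t *\<^sub>R axis i 1)) has_real_derivative partial_deriv i f (x + s *\<^sub>R axis i 1)) (at s)"
proof -
  have "((\<lambda>t. f (x + s *\<^sub>R axis i 1 + t *\<^sub>R axis i 1)) has_real_derivative
          partial_deriv i f (x + s *\<^sub>R axis i 1)) (at 0)"
    by (rule C1_on_has_partial_deriv[OF assms])
  moreover have "x + s *\<^sub>R axis i 1 + t *\<^sub>R axis i 1 = x + (t + s) *\<^sub>R axis i 1" for t :: real
    by (simp add: algebra_simps)
  ultimately show ?thesis
    using DERIV_shift[of "\<lambda>t. f (x + t *\<^sub>R axis i 1)" _ 0 s] by simp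
qed

lemma C2_on_second_order_along_axis:
  assumes "open S" "C2_on S f" "x \<in> S"
  shows "has_second_order_at0 (\<lambda>t. f (x + t *\<^sub>R axis i 1)) (partial_deriv i f x)
           (partial_deriv i (partial_deriv i f) x)"
  unfolding has_second_order_at0_def
proof (intro exI[of _ "\<lambda>t. partial_deriv i f (x + t *\<^sub>R axis i 1)"] conjI)
  show "\<forall>\<^sub>F t in nhds 0. ((\<lambda>t. f (x + t *\<^sub>R axis i 1)) has_real_derivative
          partial_deriv i f (x + t *\<^sub>R axis i 1)) (at t)"
    using eventually_line_in_open[OF assms(1,3), of "axis i 1"]
    by eventually_elim (use assms(2) in \<open>auto simp: C2_on_def intro: C1_on_has_partial_deriv_shifted\<close>)
  show "((\<lambda>t. partial_deriv i f (x + t *\<^sub>R axis i 1)) has_real_derivative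
          partial_deriv i (partial_deriv i f) x) (at 0)"
    using assms(2,3) by (auto simp: C2_on_def intro: C1_on_has_partial_deriv)
qed simp

section \<open>The convexity gap at an interior maximum\<close>

text \<open>The sign is chosen so that a positive value means failure of concavity; a function is concave
on a convex set exactly when no gap with weight in [0, 1] is positive there.\<close>

definition convexity_gap :: "('a::real_vector \<Rightarrow> real) \<Rightarrow> 'a \<Rightarrow> 'a \<Rightarrow> real \<Rightarrow> real" where
  "convexity_gap w x y l = l * w x + (1 - l) * w y - w (l *\<^sub>R x + (1 - l) *\<^sub>R y)"

lemma convexity_gap_swap: "convexity_gap w x y l = convexity_gap w y x (1 - l)"
  by (simp add: convexity_gap_def algebra_simps)

text \<open>The harmonic mean of p and q is the minimum of the right-hand side over all a and b with
l a + (1 - l) b = 1: this is the Cauchy-Schwarz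
inequality, and the defect is a multiple of (a p - b q) squared. It is the point where the
harmonic mean in the hypothesis on g meets the second-order test, whose left-hand side is
quadratic in the speeds a and b.\<close>

lemma weighted_harmonic_mean_le:
  fixes a b l p q :: real
  assumes "0 < p" "0 < q" "0 \<le> l" "l \<le> 1"
  shows "(l * a + (1 - l) * b)\<^sup>2 * (p * q / ((1 - l) * p + l * q)) \<le> l * a\<^sup>2 * p + (1 - l) * b\<^sup>2 * q"
proof -
  have pos: "(1 - l) * p + l * q > 0"
  proof (cases "l = 1")
    case False
    then have "(1 - l) * p > 0" "l * q \<ge> 0" using assms by auto
    then show ?thesis by linarith
  qed (use assms in simp)
  have "(l * a\<^sup>2 * p + (1 - l) * b\<^sup>2 * q) * ((1 - l) * p + l * q) - (l * a + (1 - l) * b)\<^sup>2 * (p * q)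
      = l * (1 - l) * (a * p - b * q)\<^sup>2"
    by (simp add: power2_eq_square algebra_simps)
  also have "\<dots> \<ge> 0" using assms by simp
  finally show ?thesis using pos by (simp add: field_simps)
qed

text \<open>Move only x by t d. The convex combination then moves by l t d, and stationarity of the gap in t
gives equal directional derivatives.\<close>

lemma interior_max_gradients_equal:
  fixes w :: "real ^ 'n::finite \<Rightarrow> real"
  assumes "open S" "x \<in> S" "0 < l"
    and max: "\<And>z. z \<in> S \<Longrightarrow> convexity_gap w z y l \<le> convexity_gap w x y l"
    and dx: "((\<lambda>t. w (x + t *\<^sub>R d)) has_real_derivative a) (at 0)"
    and dz: "((\<lambda>t. w (l *\<^sub>R x + (1 - l) *\<^sub>R y + t *\<^sub>R d)) has_real_derivative b) (at 0)"
  shows "a = b"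
proof -
  define f where "f t = l * w (x + t *\<^sub>R d) - w (l *\<^sub>R x + (1 - l) *\<^sub>R y + (l * t) *\<^sub>R d)" for t
  have "((\<lambda>t. w (l *\<^sub>R x + (1 - l) *\<^sub>R y + (l * t) *\<^sub>R d)) has_real_derivative b * l) (at 0)"
    by (rule DERIV_chain2[where g = "\<lambda>t. l * t"]) (use dz in \<open>auto intro!: derivative_eq_intros\<close>)
  then have "(f has_real_derivative l * a - b * l) (at 0)"
    unfolding f_def using dx by (intro DERIV_diff DERIV_cmult) auto
  moreover have "\<forall>\<^sub>F t in nhds 0. f t \<le> f 0"
    using eventually_line_in_open[OF assms(1,2), of d]
  proof eventually_elim
    case (elim t)
    from max[OF elim] show ?case
      by (simp add: f_def convexity_gap_def algebra_simps)
  qed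
  ultimately have "l * a - b * l = 0" by (rule has_real_derivative_local_max_0)
  then show ?thesis using \<open>0 < l\<close> by simp
qed

text \<open>The two endpoints are moved along the same direction d with independent speeds a and b. This
freedom is essential: equal speeds would only compare the arithmetic mean of the second
derivatives with q2, which does not exploit a harmonic concavity hypothesis.\<close>

lemma interior_max_second_order:
  fixes w :: "real ^ 'n::finite \<Rightarrow> real"
  assumes "open S" "x \<in> S" "y \<in> S"
    and max: "\<And>z z'. z \<in> S \<Longrightarrow> z' \<in> S \<Longrightarrow> convexity_gap w z z' l \<le> convexity_gap w x y l"
    and dx: "has_second_order_at0 (\<lambda>t. w (x + t *\<^sub>R d)) p1 q1"
    and dy: "has_second_order_at0 (\<lambda>t. w (y + t *\<^sub>R d)) p3 q3"
    and dz: "has_second_order_at0 (\<lambda>t. w (l *\<^sub>R x + (1 - l) *\<^sub>R y + t *\<^sub>R d)) p2 q2"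
  shows "l * a\<^sup>2 * q1 + (1 - l) * b\<^sup>2 * q3 \<le> (l * a + (1 - l) * b)\<^sup>2 * q2"
proof -
  define c where "c = l * a + (1 - l) * b"
  define f where "f t = (l * w (x + (a * t) *\<^sub>R d) + (1 - l) * w (y + (b * t) *\<^sub>R d))
      + (- 1) * w (l *\<^sub>R x + (1 - l) *\<^sub>R y + (c * t) *\<^sub>R d)" for t
  have "has_second_order_at0 f ((l * (a * p1) + (1 - l) * (b * p3)) + (- 1) * (c * p2))
          ((l * (a\<^sup>2 * q1) + (1 - l) * (b\<^sup>2 * q3)) + (- 1) * (c\<^sup>2 * q2))"
    unfolding f_def
    by (intro has_second_order_at0_add has_second_order_at0_cmult
        has_second_order_at0_rescale[OF dx] has_second_order_at0_rescale[OF dy]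
        has_second_order_at0_rescale[OF dz])
  moreover have "\<forall>\<^sub>F t in nhds 0. f t \<le> f 0"
    using eventually_line_in_open[OF assms(1,2), of "a *\<^sub>R d"]
      eventually_line_in_open[OF assms(1,3), of "b *\<^sub>R d"]
  proof eventually_elim
    case (elim t)
    from max[OF elim] show ?case
      by (simp add: f_def c_def convexity_gap_def algebra_simps)
  qed
  ultimately have "(l * (a\<^sup>2 * q1) + (1 - l) * (b\<^sup>2 * q3)) + (- 1) * (c\<^sup>2 * q2) \<le> 0"
    by (rule has_second_order_at0_local_max)
  then show ?thesis by (simp add: c_def algebra_simps)
qed

text \<open>The core estimate. At an interior maximum all three gradients agree, so
A = 1 + c (sum of squares of the gradient) is common to the three points. Summing the
second-order test over the axes, with the speeds chosen as w x and w y, turns the singular terms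
A / w of the equation into exactly A times the weighted mean W, because l (w x)^2 (A / w x)
+ (1 - l) (w y)^2 (A / w y) = A W. The remaining h terms are at least W^2 times the harmonic mean
of h (w x) and h (w y), hence at least W^2 (h W - delta). As h is nondecreasing, what is left is
A (1 / w z - 1 / W) \<le> delta at the intermediate point z, and the left side is at least
(W - w z) / M^2, that is, the gap divided by M^2.\<close>

lemma interior_max_gap_le:
  fixes w :: "real ^ 'n::finite \<Rightarrow> real"
  assumes S: "open S" "convex S" and xy: "x \<in> S" "y \<in> S" and l: "0 < l" "l < 1"
    and w: "\<And>z. z \<in> S \<Longrightarrow> 0 < w z \<and> w z \<le> M"
    and k: "k > 0" and c: "c \<ge> 0" and delta: "\<delta> \<ge> 0"
    and pde: "\<And>z. z \<in> S \<Longrightarrow> \<exists>p q.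
        (\<forall>i. has_second_order_at0 (\<lambda>t. w (z + t *\<^sub>R axis i 1)) (p i) (q i)) \<and>
        (\<Sum>i\<in>UNIV. q i) = k * (h (w z) - (1 + c * (\<Sum>i\<in>UNIV. (p i)\<^sup>2)) / w z)"
    and h_pos: "\<And>s. 0 < s \<Longrightarrow> s \<le> M \<Longrightarrow> 0 < h s"
    and h_mono: "\<And>s t. 0 < s \<Longrightarrow> s \<le> t \<Longrightarrow> t \<le> M \<Longrightarrow> h s \<le> h t"
    and h_HC: "\<And>s t. 0 < s \<Longrightarrow> s \<le> M \<Longrightarrow> 0 < t \<Longrightarrow> t \<le> M \<Longrightarrow> HC h s t l \<le> \<delta>"
    and max: "\<And>z z'. z \<in> S \<Longrightarrow> z' \<in> S \<Longrightarrow> convexity_gap w z z' l \<le> convexity_gap w x y l"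
  shows "convexity_gap w x y l \<le> M\<^sup>2 * \<delta>"
proof (cases "convexity_gap w x y l > 0")
  case False
  then show ?thesis using delta by (smt (verit) mult_nonneg_nonneg zero_le_power2)
next
  case True
  define z where "z = l *\<^sub>R x + (1 - l) *\<^sub>R y"
  define K where "K = convexity_gap w x y l"
  have z: "z \<in> S" unfolding z_def using S(2) xy l by (intro convexD) auto
  define W where "W = l * w x + (1 - l) * w y"
  have K: "K = W - w z" by (simp add: K_def W_def z_def convexity_gap_def)
  have Wpos: "W > 0" unfolding W_def using w[OF xy(1)] w[OF xy(2)] l by (simp add: add_pos_pos)
  have WM: "W \<le> M" unfolding W_def using w[OF xy(1)] w[OF xy(2)] l by (intro convex_bound_le) auto
  obtain p1 q1 where 1: "\<And>i. has_second_order_at0 (\<lambda>t. w (x + t *\<^sub>R axis i 1)) (p1 i) (q1 i)"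
    "(\<Sum>i\<in>UNIV. q1 i) = k * (h (w x) - (1 + c * (\<Sum>i\<in>UNIV. (p1 i)\<^sup>2)) / w x)"
    using pde[OF xy(1)] by blast
  obtain p3 q3 where 3: "\<And>i. has_second_order_at0 (\<lambda>t. w (y + t *\<^sub>R axis i 1)) (p3 i) (q3 i)"
    "(\<Sum>i\<in>UNIV. q3 i) = k * (h (w y) - (1 + c * (\<Sum>i\<in>UNIV. (p3 i)\<^sup>2)) / w y)"
    using pde[OF xy(2)] by blast
  obtain p2 q2 where 2: "\<And>i. has_second_order_at0 (\<lambda>t. w (z + t *\<^sub>R axis i 1)) (p2 i) (q2 i)"
    "(\<Sum>i\<in>UNIV. q2 i) = k * (h (w z) - (1 + c * (\<Sum>i\<in>UNIV. (p2 i)\<^sup>2)) / w z)"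
    using pde[OF z] by blast
  have p12: "p1 i = p2 i" for i
    by (rule interior_max_gradients_equal[OF S(1) xy(1) l(1) max[OF _ xy(2)]
          has_second_order_at0_D[OF 1(1)] has_second_order_at0_D[OF 2(1)[unfolded z_def]]])
  have z_swap: "z = (1 - l) *\<^sub>R y + (1 - (1 - l)) *\<^sub>R x" by (simp add: z_def add.commute)
  have p32: "p3 i = p2 i" for i
  proof (rule interior_max_gradients_equal[OF S(1) xy(2) _ _
          has_second_order_at0_D[OF 3(1)] has_second_order_at0_D[OF 2(1)[unfolded z_swap]]])
    show "0 < 1 - l" using l by simp
    fix z' assume "z' \<in> S"
    from max[OF xy(1) this] show "convexity_gap w z' x (1 - l) \<le> convexity_gap w y x (1 - l)"
      using convexity_gap_swap[of w x _ l] by metis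
  qed
  define A where "A = 1 + c * (\<Sum>i\<in>UNIV. (p2 i)\<^sup>2)"
  have A: "A \<ge> 1" unfolding A_def using c by (simp add: sum_nonneg)
  \<comment> \<open>each endpoint moves at a speed equal to its value of w, so the intermediate point moves at speed W\<close>
  have "(\<Sum>i\<in>UNIV. l * (w x)\<^sup>2 * q1 i + (1 - l) * (w y)\<^sup>2 * q3 i) \<le> (\<Sum>i\<in>UNIV. W\<^sup>2 * q2 i)"
    unfolding W_def
    by (intro sum_mono interior_max_second_order[OF S(1) xy max 1(1) 3(1) 2(1)[unfolded z_def]])
  then have "l * (w x)\<^sup>2 * sum q1 UNIV + (1 - l) * (w y)\<^sup>2 * sum q3 UNIV \<le> W\<^sup>2 * sum q2 UNIV"
    by (simp add: sum.distrib sum_distrib_left)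
  then have "k * (l * (w x)\<^sup>2 * (h (w x) - A / w x) + (1 - l) * (w y)\<^sup>2 * (h (w y) - A / w y))
      \<le> k * (W\<^sup>2 * (h (w z) - A / w z))"
    unfolding 1(2) 2(2) 3(2) p12 p32 A_def[symmetric] by (simp add: algebra_simps)
  then have "l * (w x)\<^sup>2 * (h (w x) - A / w x) + (1 - l) * (w y)\<^sup>2 * (h (w y) - A / w y)
      \<le> W\<^sup>2 * (h (w z) - A / w z)"
    using k by simp
  moreover have "l * (w x)\<^sup>2 * (h (w x) - A / w x) + (1 - l) * (w y)\<^sup>2 * (h (w y) - A / w y)
      = l * (w x)\<^sup>2 * h (w x) + (1 - l) * (w y)\<^sup>2 * h (w y) - A * W"
    using w[OF xy(1)] w[OF xy(2)] by (simp add: W_def power2_eq_square field_simps)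
  ultimately have second: "l * (w x)\<^sup>2 * h (w x) + (1 - l) * (w y)\<^sup>2 * h (w y) - A * W
      \<le> W\<^sup>2 * (h (w z) - A / w z)" by simp
  have "W\<^sup>2 * (h W - \<delta>) \<le> W\<^sup>2 * (h (w x) * h (w y) / ((1 - l) * h (w x) + l * h (w y)))"
    using h_HC[of "w x" "w y"] w[OF xy(1)] w[OF xy(2)]
    by (intro mult_left_mono) (auto simp: HC_def W_def)
  also have "\<dots> \<le> l * (w x)\<^sup>2 * h (w x) + (1 - l) * (w y)\<^sup>2 * h (w y)"
    unfolding W_def using w[OF xy(1)] w[OF xy(2)] l h_pos
    by (intro weighted_harmonic_mean_le) auto
  finally have "W\<^sup>2 * (h W - \<delta>) - A * W \<le> W\<^sup>2 * (h (w z) - A / w z)" using second by simp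
  moreover have "W\<^sup>2 * h (w z) \<le> W\<^sup>2 * h W"
    using h_mono[of "w z" W] w[OF z] WM True by (intro mult_left_mono) (auto simp: K K_def[symmetric])
  ultimately have "W\<^sup>2 * (A / w z) - A * W \<le> W\<^sup>2 * \<delta>" by (simp add: algebra_simps)
  moreover have "W\<^sup>2 * (A / w z) - A * W = A * (W * K / w z)"
    using w[OF z] by (simp add: K power2_eq_square field_simps)
  ultimately have "A * (W * K / w z) \<le> W\<^sup>2 * \<delta>" by simp
  moreover have "W * K / w z \<le> A * (W * K / w z)"
    using mult_right_mono[OF A, of "W * K / w z"] True w[OF z] Wpos by (simp add: K_def)
  ultimately have "W * K / w z \<le> W * (W * \<delta>)" by (simp add: power2_eq_square)
  then have "W * K \<le> W * (w z * (W * \<delta>))" using w[OF z] by (simp add: field_simps)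
  then have "K \<le> (w z * W) * \<delta>" using Wpos by simp
  also have "\<dots> \<le> (M * M) * \<delta>" using w[OF z] Wpos WM delta
    by (intro mult_right_mono mult_mono) auto
  finally show ?thesis by (simp add: K_def power2_eq_square)
qed

section \<open>Linear growth of superharmonic functions at the boundary\<close>

lemma norm_along_axis_squared:
  fixes x y :: "real ^ 'n::finite"
  shows "(norm (x + t *\<^sub>R axis i 1 - y))\<^sup>2 = (norm (x - y))\<^sup>2 + 2 * t * (x - y) $ i + t\<^sup>2"
proof -
  define d where "d = x - y"
  have "x + t *\<^sub>R axis i 1 - y = d + t *\<^sub>R axis i 1" by (simp add: d_def)
  moreover have "(norm (d + t *\<^sub>R axis i 1))\<^sup>2 = (norm d)\<^sup>2 + 2 * t * d $ i + t\<^sup>2"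
    unfolding power2_norm_eq_inner
    by (simp add: inner_add_left inner_add_right inner_axis inner_axis' power2_eq_square algebra_simps)
  ultimately show ?thesis by (simp only: d_def)
qed

lemma has_second_order_at0_gaussian:
  fixes x y :: "real ^ 'n::finite"
  shows "has_second_order_at0 (\<lambda>t. exp (- \<alpha> * (norm (x + t *\<^sub>R axis i 1 - y))\<^sup>2))
    (- 2 * \<alpha> * (x - y) $ i * exp (- \<alpha> * (norm (x - y))\<^sup>2))
    ((4 * \<alpha>\<^sup>2 * ((x - y) $ i)\<^sup>2 - 2 * \<alpha>) * exp (- \<alpha> * (norm (x - y))\<^sup>2))"
proof -
  define d where "d = (x - y) $ i"
  define E where "E t = exp (- \<alpha> * ((norm (x - y))\<^sup>2 + 2 * t * d + t\<^sup>2))" for t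
  define E' where "E' t = E t * (- \<alpha> * (2 * d + 2 * t))" for t
  have E: "(E has_real_derivative E' t) (at t)" for t
    unfolding E_def E'_def
    by (rule DERIV_fun_exp) (auto intro!: derivative_eq_intros simp: algebra_simps)
  have "((\<lambda>t. - \<alpha> * (2 * d + 2 * t)) has_real_derivative - 2 * \<alpha>) (at 0)"
    by (auto intro!: derivative_eq_intros)
  from DERIV_mult[OF E[of 0] this]
  have "(E' has_real_derivative E' 0 * (- \<alpha> * (2 * d)) + - 2 * \<alpha> * E 0) (at 0)"
    by (simp add: E'_def[abs_def])
  also have "E' 0 * (- \<alpha> * (2 * d)) + - 2 * \<alpha> * E 0 = (4 * \<alpha>\<^sup>2 * d\<^sup>2 - 2 * \<alpha>) * E 0"
    by (simp add: E'_def power2_eq_square algebra_simps)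
  finally have "has_second_order_at0 E (- 2 * \<alpha> * d * E 0) ((4 * \<alpha>\<^sup>2 * d\<^sup>2 - 2 * \<alpha>) * E 0)"
    unfolding has_second_order_at0_def
    by (intro exI[of _ E'] conjI always_eventually allI E) (simp add: E'_def)
  moreover have "(\<lambda>t. exp (- \<alpha> * (norm (x + t *\<^sub>R axis i 1 - y))\<^sup>2)) = E"
    unfolding E_def norm_along_axis_squared d_def ..
  moreover have "exp (- \<alpha> * (norm (x - y))\<^sup>2) = E 0" by (simp add: E_def)
  ultimately show ?thesis by (simp only: d_def)
qed

text \<open>Far enough from its centre a Gaussian is strictly subharmonic: its Laplacian is
2 \<alpha> (2 \<alpha> |x - y|^2 - n) times its value. Subtracting a positive multiple from a
superharmonic function gives a strictly negative Laplacian, which excludes a local minimum.\<close>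

lemma superharmonic_minus_gaussian_no_local_min:
  fixes u :: "real ^ 'n::finite \<Rightarrow> real"
  assumes S: "open S" "C2_on S u" and lap: "laplacian u x \<le> 0" and x: "x \<in> S" and e: "e > 0" "\<alpha> > 0"
    and far: "2 * \<alpha> * (norm (x - y))\<^sup>2 > real CARD('n)"
    and nbhd: "open N" "x \<in> N"
    and min: "\<And>z. z \<in> N \<Longrightarrow> u x - e * exp (- \<alpha> * (norm (x - y))\<^sup>2) \<le> u z - e * exp (- \<alpha> * (norm (z - y))\<^sup>2)"
  shows False
proof -
  define G where "G z = exp (- \<alpha> * (norm (z - y))\<^sup>2)" for z
  have "(- 1) * partial_deriv i (partial_deriv i u) x
      + e * ((4 * \<alpha>\<^sup>2 * ((x - y) $ i)\<^sup>2 - 2 * \<alpha>) * G x) \<le> 0" for i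
  proof (rule has_second_order_at0_local_max)
    show "has_second_order_at0
      (\<lambda>t. (- 1) * u (x + t *\<^sub>R axis i 1) + e * G (x + t *\<^sub>R axis i 1))
      ((- 1) * partial_deriv i u x + e * (- 2 * \<alpha> * (x - y) $ i * G x))
      ((- 1) * partial_deriv i (partial_deriv i u) x
        + e * ((4 * \<alpha>\<^sup>2 * ((x - y) $ i)\<^sup>2 - 2 * \<alpha>) * G x))"
      unfolding G_def
      by (intro has_second_order_at0_add has_second_order_at0_cmult
          C2_on_second_order_along_axis[OF S x] has_second_order_at0_gaussian)
    show "\<forall>\<^sub>F t in nhds 0. (- 1) * u (x + t *\<^sub>R axis i 1) + e * G (x + t *\<^sub>R axis i 1)
       \<le> (- 1) * u (x + 0 *\<^sub>R axis i 1) + e * G (x + 0 *\<^sub>R axis i 1)"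
      using eventually_line_in_open[OF nbhd, of "axis i 1"]
      by eventually_elim (use min in \<open>simp add: G_def algebra_simps\<close>)
  qed
  then have "(\<Sum>i\<in>UNIV. e * ((4 * \<alpha>\<^sup>2 * ((x - y) $ i)\<^sup>2 - 2 * \<alpha>) * G x)) \<le> laplacian u x"
    unfolding laplacian_def by (intro sum_mono) (simp add: algebra_simps)
  also have "(\<Sum>i\<in>UNIV. e * ((4 * \<alpha>\<^sup>2 * ((x - y) $ i)\<^sup>2 - 2 * \<alpha>) * G x))
      = e * G x * (4 * \<alpha>\<^sup>2 * (\<Sum>i\<in>UNIV. ((x - y) $ i)\<^sup>2) - 2 * \<alpha> * real CARD('n))"
    by (simp add: sum_subtractf sum_distrib_left sum_distrib_right algebra_simps)
  also have "(\<Sum>i\<in>UNIV. ((x - y) $ i)\<^sup>2) = (norm (x - y))\<^sup>2"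
    unfolding power2_norm_eq_inner inner_vec_def by (simp add: power2_eq_square)
  also have "4 * \<alpha>\<^sup>2 * (norm (x - y))\<^sup>2 - 2 * \<alpha> * real CARD('n)
      = 2 * \<alpha> * (2 * \<alpha> * (norm (x - y))\<^sup>2 - real CARD('n))"
    by (simp add: power2_eq_square algebra_simps)
  finally have "e * G x * (2 * \<alpha> * (2 * \<alpha> * (norm (x - y))\<^sup>2 - real CARD('n))) \<le> laplacian u x" .
  moreover have "e * G x * (2 * \<alpha> * (2 * \<alpha> * (norm (x - y))\<^sup>2 - real CARD('n))) > 0"
    using e far by (simp add: G_def)
  ultimately show False using lap by linarith
qed

text \<open>The minimum of u minus a small multiple of the Gaussian over the closed annulus lies on one of the
two bounding spheres. On the outer one u is nonnegative; on the inner one u has a positive lower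
bound e, which also serves as the multiple since the Gaussian is at most 1.\<close>

lemma barrier_below_superharmonic:
  fixes u :: "real ^ 'n::finite \<Rightarrow> real"
  assumes S: "open S" "C2_on S u" and lap: "\<And>x. x \<in> S \<Longrightarrow> laplacian u x \<le> 0"
    and cont: "continuous_on (closure S) u"
    and pos: "\<And>x. x \<in> S \<Longrightarrow> u x > 0" and nonneg: "\<And>x. x \<in> closure S \<Longrightarrow> u x \<ge> 0"
    and ball: "ball y r \<subseteq> S" and r: "r > 0" and \<alpha>: "\<alpha> > 0" "\<alpha> * r\<^sup>2 > 2 * real CARD('n)"
  obtains e where "e > 0"
    "\<And>x. r / 2 \<le> norm (x - y) \<Longrightarrow> norm (x - y) \<le> r \<Longrightarrow>
       e * (exp (- \<alpha> * (norm (x - y))\<^sup>2) - exp (- \<alpha> * r\<^sup>2)) \<le> u x"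
proof -
  have cball: "cball y r \<subseteq> closure S"
    using closure_mono[OF ball] r by simp
  have "continuous_on (cball y (r/2)) u"
    by (rule continuous_on_subset[OF cont]) (use cball r in \<open>auto simp: subset_iff\<close>)
  then obtain z0 where z0: "z0 \<in> cball y (r/2)" "\<And>z. z \<in> cball y (r/2) \<Longrightarrow> u z0 \<le> u z"
    using continuous_attains_inf[of "cball y (r/2)" u] r by fastforce
  define e where "e = u z0"
  have "z0 \<in> S" using z0(1) ball r by (auto simp: subset_iff)
  then have e: "e > 0" using pos by (simp add: e_def)
  define G where "G z = exp (- \<alpha> * (norm (z - y))\<^sup>2)" for z
  define f where "f z = u z - e * G z" for z
  define R where "R = cball y r - ball y (r/2)"
  have "compact R" unfolding R_def by (simp add: compact_diff)
  have sph: "x \<in> R" if "norm (x - y) = r" for x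
    using that r by (auto simp: R_def dist_norm norm_minus_commute)
  have "continuous_on R f"
    unfolding f_def G_def
    by (intro continuous_intros continuous_on_subset[OF cont]) (use cball in \<open>auto simp: R_def\<close>)
  moreover have "R \<noteq> {}"
  proof -
    have "norm ((y + r *\<^sub>R axis undefined 1) - y) = r" using r by simp
    from sph[OF this] show ?thesis by blast
  qed
  ultimately obtain x where x: "x \<in> R" "\<And>z. z \<in> R \<Longrightarrow> f x \<le> f z"
    using continuous_attains_inf[OF \<open>compact R\<close>] by blast
  have dx: "r/2 \<le> norm (x - y)" "norm (x - y) \<le> r"
    using x(1) by (auto simp: R_def dist_norm norm_minus_commute)
  have xS: "x \<in> closure S" using x(1) cball by (auto simp: R_def)
  have key: "- e * exp (- \<alpha> * r\<^sup>2) \<le> f x"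
  proof -
    consider "norm (x - y) = r" | "norm (x - y) = r / 2" | "r/2 < norm (x - y)" "norm (x - y) < r"
      using dx by linarith
    then show ?thesis
    proof cases
      case 1
      then show ?thesis using nonneg[OF xS] by (simp add: f_def G_def)
    next
      case 2
      then have "x \<in> cball y (r/2)" by (simp add: dist_norm norm_minus_commute)
      then have "e \<le> u x" using z0(2) by (simp add: e_def)
      moreover have "e * G x \<le> e * 1" using e \<alpha>(1) by (intro mult_left_mono) (auto simp: G_def)
      moreover have "- e * exp (- \<alpha> * r\<^sup>2) \<le> 0" using e by simp
      ultimately show ?thesis by (simp add: f_def)
    next
      case 3
      define N where "N = ball y r - cball y (r/2)"
      have "open N" "x \<in> N" "N \<subseteq> R"
        using 3 by (auto simp: N_def R_def dist_norm norm_minus_commute)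
      have "x \<in> S" using 3 ball by (auto simp: dist_norm norm_minus_commute subset_iff)
      have "(r/2)\<^sup>2 \<le> (norm (x - y))\<^sup>2" using dx r by (intro power_mono) auto
      then have "2 * \<alpha> * (r/2)\<^sup>2 \<le> 2 * \<alpha> * (norm (x - y))\<^sup>2" using \<alpha>(1) by (intro mult_left_mono) auto
      moreover have "2 * \<alpha> * (r/2)\<^sup>2 = \<alpha> * r\<^sup>2 / 2" by (simp add: power2_eq_square)
      ultimately have "2 * \<alpha> * (norm (x - y))\<^sup>2 > real CARD('n)" using \<alpha>(2) by linarith
      then have False
        using superharmonic_minus_gaussian_no_local_min[OF S lap[OF \<open>x \<in> S\<close>] \<open>x \<in> S\<close> e \<alpha>(1) _ \<open>open N\<close> \<open>x \<in> N\<close>]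
          x(2) \<open>N \<subseteq> R\<close> unfolding f_def G_def by blast
      then show ?thesis ..
    qed
  qed
  show thesis
  proof
    show "e > 0" by (rule e)
    fix z assume "r / 2 \<le> norm (z - y)" "norm (z - y) \<le> r"
    then have "z \<in> R" by (auto simp: R_def dist_norm norm_minus_commute)
    from x(2)[OF this] key
    show "e * (exp (- \<alpha> * (norm (z - y))\<^sup>2) - exp (- \<alpha> * r\<^sup>2)) \<le> u z"
      by (simp add: f_def G_def algebra_simps)
  qed
qed

text \<open>A form of the Hopf boundary point lemma. The inward normal at x is y - x; instead of following it,
one follows a coordinate axis along which y - x has a nonzero component a. This direction also
enters the ball transversally, so the barrier, and with it u, grows at least linearly.\<close>

lemma superharmonic_linear_boundary_growth:
  fixes u :: "real ^ 'n::finite \<Rightarrow> real"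
  assumes S: "open S" "C2_on S u" and lap: "\<And>x. x \<in> S \<Longrightarrow> laplacian u x \<le> 0"
    and cont: "continuous_on (closure S) u"
    and pos: "\<And>x. x \<in> S \<Longrightarrow> u x > 0" and nonneg: "\<And>x. x \<in> closure S \<Longrightarrow> u x \<ge> 0"
    and ball: "ball y r \<subseteq> S" and r: "r > 0" and x: "x \<in> sphere y r"
  obtains i a c where "c > 0"
    "\<forall>\<^sub>F t in at_right 0. x + t *\<^sub>R (a *\<^sub>R axis i 1) \<in> S \<and> c * t \<le> u (x + t *\<^sub>R (a *\<^sub>R axis i 1))"
proof -
  have nx: "norm (x - y) = r" using x by (simp add: dist_norm norm_minus_commute)
  then have "x - y \<noteq> 0" using r by auto
  then obtain i where i: "(x - y) $ i \<noteq> 0" by (metis vec_eq_iff zero_index)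
  define a where "a = - ((x - y) $ i)"
  have a: "a\<^sup>2 > 0" using i by (simp add: a_def)
  have "\<bar>a\<bar> \<le> r" using component_le_norm_cart[of "x - y" i] nx by (simp add: a_def)
  then have ar: "a\<^sup>2 \<le> r\<^sup>2" by (simp add: abs_le_square_iff[symmetric])
  \<comment> \<open>any factor above 2 makes the Gaussian subharmonic outside the ball of radius r / 2\<close>
  define \<alpha> where "\<alpha> = 3 * real CARD('n) / r\<^sup>2"
  have \<alpha>: "\<alpha> > 0" "\<alpha> * r\<^sup>2 > 2 * real CARD('n)" using r by (auto simp: \<alpha>_def)
  obtain e where e: "e > 0" "\<And>x. r / 2 \<le> norm (x - y) \<Longrightarrow> norm (x - y) \<le> r \<Longrightarrow>
       e * (exp (- \<alpha> * (norm (x - y))\<^sup>2) - exp (- \<alpha> * r\<^sup>2)) \<le> u x"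
    using barrier_below_superharmonic[OF S lap cont pos nonneg ball r \<alpha>] by blast
  define c where "c = e * exp (- \<alpha> * r\<^sup>2) * \<alpha> * a\<^sup>2"
  have c: "c > 0" using e(1) \<alpha>(1) a by (simp add: c_def)
  have "\<forall>\<^sub>F t in at_right 0. (0::real) < t \<and> t < 1/4"
    unfolding eventually_at_right_field by (intro exI[of _ "1/4"]) auto
  then have "\<forall>\<^sub>F t in at_right 0. x + t *\<^sub>R (a *\<^sub>R axis i 1) \<in> S \<and> c * t \<le> u (x + t *\<^sub>R (a *\<^sub>R axis i 1))"
  proof eventually_elim
    case (elim t)
    define z where "z = x + t *\<^sub>R (a *\<^sub>R axis i 1)"
    have zn: "(norm (z - y))\<^sup>2 = r\<^sup>2 - 2 * t * a\<^sup>2 + t\<^sup>2 * a\<^sup>2"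
      using norm_along_axis_squared[of x "t * a" i y] nx
      by (simp add: z_def a_def power2_eq_square algebra_simps)
    have "t\<^sup>2 * a\<^sup>2 \<le> t * a\<^sup>2" using elim by (intro mult_right_mono) (auto simp: power2_eq_square)
    then have up: "(norm (z - y))\<^sup>2 \<le> r\<^sup>2 - t * a\<^sup>2" using zn by simp
    have ta: "t * a\<^sup>2 > 0" using elim a by simp
    have "2 * t * a\<^sup>2 \<le> 2 * (1/4) * r\<^sup>2" using elim ar by (intro mult_mono) auto
    moreover have "0 \<le> t\<^sup>2 * a\<^sup>2" by simp
    ultimately have "r\<^sup>2 / 2 \<le> (norm (z - y))\<^sup>2" using zn by linarith
    moreover have "(r/2)\<^sup>2 \<le> r\<^sup>2 / 2" by (simp add: power_divide)
    ultimately have "(r/2)\<^sup>2 \<le> (norm (z - y))\<^sup>2" by linarith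
    then have lo: "r/2 \<le> norm (z - y)" by (rule power2_le_imp_le) simp
    have "(norm (z - y))\<^sup>2 < r\<^sup>2" using up ta by simp
    then have hi: "norm (z - y) < r" by (rule power2_less_imp_less) (use r in simp)
    have "z \<in> S" using hi ball by (auto simp: dist_norm norm_minus_commute subset_iff)
    have "c * t = e * (exp (- \<alpha> * r\<^sup>2) * (\<alpha> * (t * a\<^sup>2)))" by (simp add: c_def)
    also have "\<dots> \<le> e * (exp (- \<alpha> * r\<^sup>2) * (exp (\<alpha> * (t * a\<^sup>2)) - 1))"
    proof (intro mult_left_mono)
      show "\<alpha> * (t * a\<^sup>2) \<le> exp (\<alpha> * (t * a\<^sup>2)) - 1"
        using exp_ge_add_one_self[of "\<alpha> * (t * a\<^sup>2)"] by linarith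
    qed (use e(1) in auto)
    also have "exp (- \<alpha> * r\<^sup>2) * (exp (\<alpha> * (t * a\<^sup>2)) - 1) = exp (- \<alpha> * (r\<^sup>2 - t * a\<^sup>2)) - exp (- \<alpha> * r\<^sup>2)"
    proof -
      have "exp (- \<alpha> * r\<^sup>2) * exp (\<alpha> * (t * a\<^sup>2)) = exp (- \<alpha> * (r\<^sup>2 - t * a\<^sup>2))"
        by (subst mult_exp_exp) (simp add: algebra_simps)
      then show ?thesis by (simp add: right_diff_distrib)
    qed
    also have "e * \<dots> \<le> e * (exp (- \<alpha> * (norm (z - y))\<^sup>2) - exp (- \<alpha> * r\<^sup>2))"
      using e(1) \<alpha>(1) up by (intro mult_left_mono) auto
    also have "\<dots> \<le> u z" using e(2) lo hi by simp
    finally show ?case using \<open>z \<in> S\<close> by (simp add: z_def)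
  qed
  with c show thesis by (rule that)
qed

section \<open>The convexity gap has no maximum at the boundary\<close>

text \<open>Near the boundary point x the function u grows at least linearly along some line, so its power with exponent k < 1
has infinite slope there, while at the interior intermediate point that power is differentiable.
Moving x inward by t raises the first term of the gap by at least a multiple of t powr k,
and the subtracted term by at most a multiple of t.\<close>

lemma gap_increases_from_boundary:
  fixes u :: "real ^ 'n::finite \<Rightarrow> real"
  assumes S: "open S" "convex S" "C2_on S u" and lap: "\<And>x. x \<in> S \<Longrightarrow> laplacian u x \<le> 0"
    and cont: "continuous_on (closure S) u"
    and pos: "\<And>x. x \<in> S \<Longrightarrow> u x > 0" and bd: "\<And>x. x \<in> frontier S \<Longrightarrow> u x = 0"
    and ibc: "interior_ball_condition S"
    and k: "0 < k" "k < 1" and x: "x \<in> frontier S" and y: "y \<in> S" and l: "0 < l" "l < 1"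
  obtains z where "z \<in> S" "convexity_gap (\<lambda>z. u z powr k) x y l < convexity_gap (\<lambda>z. u z powr k) z y l"
proof -
  have nonneg: "u z \<ge> 0" if "z \<in> closure S" for z
    using that pos[of z] bd[of z] S(1) by (cases "z \<in> S") (auto simp: frontier_def interior_open)
  obtain c0 r where ball: "ball c0 r \<subseteq> S" "r > 0" "x \<in> sphere c0 r"
    using ibc x unfolding interior_ball_condition_def by blast
  obtain i a c where c: "c > 0" and grow:
    "\<forall>\<^sub>F t in at_right 0. x + t *\<^sub>R (a *\<^sub>R axis i 1) \<in> S \<and> c * t \<le> u (x + t *\<^sub>R (a *\<^sub>R axis i 1))"
    using superharmonic_linear_boundary_growth[OF S(1,3) lap cont pos nonneg ball] by blast
  define p where "p = l *\<^sub>R x + (1 - l) *\<^sub>R y"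
  have "p \<in> S"
  proof -
    have "x - (1 - l) *\<^sub>R (x - y) \<in> interior S"
      by (rule mem_interior_closure_convex_shrink) (use S x y l in \<open>auto simp: interior_open frontier_def\<close>)
    then show ?thesis using S(1) by (simp add: p_def interior_open algebra_simps)
  qed
  define f where "f t = u (p + t *\<^sub>R (l *\<^sub>R (a *\<^sub>R axis i 1))) powr k" for t
  obtain D where D: "(f has_real_derivative D) (at 0)"
  proof -
    have "has_second_order_at0 (\<lambda>t. u (p + ((l * a) * t) *\<^sub>R axis i 1))
        (l * a * partial_deriv i u p) ((l * a)\<^sup>2 * partial_deriv i (partial_deriv i u) p)"
      by (rule has_second_order_at0_rescale[OF C2_on_second_order_along_axis[OF S(1,3) \<open>p \<in> S\<close>]])
    from has_second_order_at0_D[OF has_second_order_at0_powr[OF this, of k]] pos[OF \<open>p \<in> S\<close>]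
    show thesis by (intro that) (simp add: f_def[abs_def] mult_ac)
  qed
  have "((\<lambda>t. (f t - f 0) / t) \<longlongrightarrow> D) (at_right 0)"
    using D unfolding has_field_derivative_iff by (simp add: filterlim_at_split)
  then have lip: "\<forall>\<^sub>F t in at_right 0. (f t - f 0) / t < D + 1"
    by (rule order_tendstoD(2)) simp
  have "((\<lambda>t. (D + 1) * t powr (1 - k)) \<longlongrightarrow> (D + 1) * 0 powr (1 - k)) (at_right 0)"
    using k by (intro tendsto_intros) (auto intro: eventually_mono[OF eventually_at_right_less])
  then have small: "\<forall>\<^sub>F t in at_right 0. (D + 1) * t powr (1 - k) < l * c powr k"
    by (rule order_tendstoD(2)) (use l c k in simp)
  have "\<forall>\<^sub>F t in at_right 0. (0::real) < t" by (rule eventually_at_right_less)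
  then have "\<forall>\<^sub>F t in at_right 0. x + t *\<^sub>R (a *\<^sub>R axis i 1) \<in> S \<and>
      convexity_gap (\<lambda>z. u z powr k) x y l < convexity_gap (\<lambda>z. u z powr k) (x + t *\<^sub>R (a *\<^sub>R axis i 1)) y l"
    using grow lip small
  proof eventually_elim
    case (elim t)
    define z where "z = x + t *\<^sub>R (a *\<^sub>R axis i 1)"
    have z: "z \<in> S" "c * t \<le> u z" using elim by (auto simp: z_def)
    have "f t - f 0 < (D + 1) * t" using elim by (simp add: field_simps)
    also have "\<dots> = ((D + 1) * t powr (1 - k)) * t powr k"
      using elim(1) by (simp add: powr_add[symmetric] mult.assoc)
    also have "\<dots> < l * c powr k * t powr k" using elim by (intro mult_strict_right_mono) auto
    also have "\<dots> = l * (c * t) powr k" using c elim by (simp add: powr_mult)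
    also have "\<dots> \<le> l * u z powr k" using z(2) c elim k l
      by (intro mult_left_mono powr_mono2) auto
    finally have "f t < f 0 + l * u z powr k" by simp
    moreover have "f t = u (l *\<^sub>R z + (1 - l) *\<^sub>R y) powr k" "f 0 = u (l *\<^sub>R x + (1 - l) *\<^sub>R y) powr k"
      by (simp_all add: f_def p_def z_def algebra_simps)
    moreover have "u x powr k = 0" using bd[OF x] by simp
    ultimately show ?case using z(1)
      unfolding z_def[symmetric] by (simp add: convexity_gap_def)
  qed
  from eventually_happens[OF this] show thesis using that by auto
qed

section \<open>Approximately concave functions\<close>

text \<open>Merging the points of F one at a time costs at most one gap K per step.\<close>

lemma convex_hull_hypograph_bound:
  fixes w :: "'a::real_vector \<Rightarrow> real"
  assumes S: "convex S" and K: "K \<ge> 0"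
    and gap: "\<And>x y l. x \<in> S \<Longrightarrow> y \<in> S \<Longrightarrow> 0 \<le> l \<Longrightarrow> l \<le> 1 \<Longrightarrow> convexity_gap w x y l \<le> K"
    and F: "finite F" "F \<noteq> {}" "F \<subseteq> {(x, t). x \<in> S \<and> t \<le> w x}" and xt: "(x, t) \<in> convex hull F"
  shows "x \<in> S \<and> t \<le> w x + real (card F - 1) * K"
  using F xt
proof (induction F arbitrary: x t rule: finite_ne_induct)
  case (singleton p)
  then show ?case by auto
next
  case (insert p F)
  obtain y s where p: "p = (y, s)" by force
  have y: "y \<in> S" "s \<le> w y" using insert.prems p by auto
  obtain u v z r where uv: "u \<ge> 0" "v \<ge> 0" "u + v = 1" "(z, r) \<in> convex hull F"
    "(x, t) = u *\<^sub>R p + v *\<^sub>R (z, r)"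
  proof -
    from insert.prems(2) obtain u v b where "u \<ge> 0" "v \<ge> 0" "u + v = 1" "b \<in> convex hull F"
      "(x, t) = u *\<^sub>R p + v *\<^sub>R b"
      unfolding convex_hull_insert[OF insert.hyps(2)] by blast
    then show thesis by (cases b) (rule that, auto)
  qed
  have z: "z \<in> S" "r \<le> w z + real (card F - 1) * K" using insert.IH[OF _ uv(4)] insert.prems by auto
  have v: "v = 1 - u" using uv(3) by simp
  have x: "x = u *\<^sub>R y + (1 - u) *\<^sub>R z" and t: "t = u * s + (1 - u) * r"
    using uv(5) unfolding v by (simp_all add: p)
  have u1: "u \<le> 1" using uv by simp
  have "x \<in> S" unfolding x using S y z uv(1) u1 by (intro convexD) auto
  define c where "c = real (card F - 1) * K"
  have c: "c \<ge> 0" "real (card (insert p F) - 1) * K = c + K"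
  proof -
    have "card F \<ge> 1" using insert.hyps by (simp add: Suc_leI card_gt_0_iff)
    then have "real (card (insert p F) - 1) = real (card F - 1) + 1" using insert.hyps by simp
    then show "real (card (insert p F) - 1) * K = c + K" unfolding c_def by (simp add: distrib_right)
  qed (use K in \<open>simp add: c_def\<close>)
  have "u * s \<le> u * w y" using y(2) uv(1) by (rule mult_left_mono)
  moreover have "(1 - u) * r \<le> (1 - u) * (w z + c)"
    using z(2) u1 by (intro mult_left_mono) (auto simp: c_def)
  moreover have "(1 - u) * (w z + c) \<le> (1 - u) * w z + c"
    using mult_nonneg_nonneg[OF uv(1) c(1)] by (simp add: algebra_simps)
  moreover have "u * w y + (1 - u) * w z - w x \<le> K"
    using gap[OF y(1) z(1) uv(1) u1] by (simp only: convexity_gap_def x)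
  ultimately have "t \<le> w x + real (card (insert p F) - 1) * K" unfolding t c(2) by linarith
  with \<open>x \<in> S\<close> show ?case by simp
qed

text \<open>A stability theorem of Hyers-Ulam type. The function v is the concave envelope of w: the upper
boundary of the convex hull of the hypograph. By Caratheodory's theorem in the product space, of dimension one
more than that of the domain, each point of this hull is a convex combination of at most DIM + 2 points of the hypograph, so at
most DIM + 1 merging steps are needed.\<close>

lemma approx_concave_near_concave:
  fixes w :: "'a::euclidean_space \<Rightarrow> real" and K :: real
  assumes S: "convex S" and K: "K \<ge> 0"
    and gap: "\<And>x y l. x \<in> S \<Longrightarrow> y \<in> S \<Longrightarrow> 0 \<le> l \<Longrightarrow> l \<le> 1 \<Longrightarrow> convexity_gap w x y l \<le> K"
  obtains v where "concave_on S v" "\<And>x. x \<in> S \<Longrightarrow> w x \<le> v x \<and> v x \<le> w x + (DIM('a) + 1) * K"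
proof -
  define H where "H = convex hull {(x, t). x \<in> S \<and> t \<le> w x}"
  define v where "v x = Sup {t. (x, t) \<in> H}" for x
  define B where "B x = w x + (DIM('a) + 1) * K" for x
  have bound: "t \<le> B x" if xt: "(x, t) \<in> H" for x t
  proof -
    obtain F where F: "finite F" "F \<subseteq> {(x, t). x \<in> S \<and> t \<le> w x}" "card F \<le> DIM('a \<times> real) + 1"
      "(x, t) \<in> convex hull F"
      using xt[unfolded H_def, THEN subsetD[OF equalityD1[OF Convex.caratheodory]]] by blast
    then have "F \<noteq> {}" by auto
    then have "t \<le> w x + real (card F - 1) * K"
      using convex_hull_hypograph_bound[OF S K gap F(1) _ F(2,4)] by blast
    also have "\<dots> \<le> B x" unfolding B_def using F(3) K by (intro add_left_mono mult_right_mono) auto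
    finally show ?thesis .
  qed
  have graph: "(x, w x) \<in> H" if "x \<in> S" for x
    using that unfolding H_def by (intro hull_inc) auto
  have bdd: "bdd_above {t. (x, t) \<in> H}" for x
    using bound by (intro bdd_aboveI[of _ "B x"]) auto
  have upper: "t \<le> v x" if "(x, t) \<in> H" for x t
    unfolding v_def using that bdd by (intro cSup_upper) auto
  have "v x \<le> B x" if "x \<in> S" for x
    unfolding v_def using graph[OF that] bound by (intro cSup_least) auto
  moreover have "concave_on S v"
    unfolding concave_on_iff
  proof (intro conjI ballI allI impI S)
    fix x y and a b :: real
    assume xy: "x \<in> S" "y \<in> S" and ab: "0 \<le> a" "0 \<le> b" "a + b = 1"
    show "a * v x + b * v y \<le> v (a *\<^sub>R x + b *\<^sub>R y)"
    proof (rule field_le_epsilon)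
      fix e :: real assume "e > 0"
      have b: "b = 1 - a" using ab(3) by simp
      obtain t where t: "(x, t) \<in> H" "v x - e < t"
        using less_cSupE[of "v x - e" "{t. (x, t) \<in> H}"] graph[OF xy(1)] \<open>e > 0\<close>
        by (auto simp: v_def[symmetric])
      obtain s where s: "(y, s) \<in> H" "v y - e < s"
        using less_cSupE[of "v y - e" "{t. (y, t) \<in> H}"] graph[OF xy(2)] \<open>e > 0\<close>
        by (auto simp: v_def[symmetric])
      have "a *\<^sub>R (x, t) + b *\<^sub>R (y, s) \<in> H"
        using t s ab unfolding H_def by (intro convexD convex_convex_hull) auto
      then have "a * t + b * s \<le> v (a *\<^sub>R x + b *\<^sub>R y)" by (intro upper) simp
      moreover have "a * (v x - e) + b * (v y - e) \<le> a * t + b * s"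
        using t s ab by (intro add_mono mult_left_mono) auto
      moreover have "a * (v x - e) + b * (v y - e) = a * v x + b * v y - e"
        unfolding b by (simp add: algebra_simps)
      ultimately show "a * v x + b * v y \<le> v (a *\<^sub>R x + b *\<^sub>R y) + e" by simp
    qed
  qed
  ultimately show thesis using upper[OF graph] by (intro that) (auto simp: B_def)
qed

section \<open>The essential supremum of continuous functions\<close>

text \<open>The essential bound holds everywhere, since the set where a continuous function exceeds it is open
and null, hence empty.\<close>

lemma continuous_le_Linfty_norm:
  fixes f :: "'a::euclidean_space \<Rightarrow> real"
  assumes "open S" "continuous_on S f" "Linfty_norm S f = ereal m" "x \<in> S"
  shows "\<bar>f x\<bar> \<le> m"
proof (rule ccontr)
  assume "\<not> \<bar>f x\<bar> \<le> m"
  define U where "U = {x \<in> S. m < \<bar>f x\<bar>}"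
  have "open U"
  proof -
    have "U = S \<inter> (\<lambda>x. \<bar>f x\<bar>) -` {m<..}" by (auto simp: U_def)
    then show ?thesis
      using assms(1,2) by (auto intro!: continuous_open_preimage continuous_intros)
  qed
  have "AE x in lebesgue_on S. ereal \<bar>f x\<bar> \<le> ereal m"
    using esssup_AE[of "\<lambda>x. ereal \<bar>f x\<bar>" "lebesgue_on S"] assms(3) by (simp add: Linfty_norm_def)
  then have "AE x in lebesgue. x \<in> S \<longrightarrow> \<bar>f x\<bar> \<le> m"
    using assms(1) by (simp add: AE_restrict_space_iff)
  then have "AE x in lebesgue. x \<notin> U" by eventually_elim (auto simp: U_def)
  then have "negligible U"
    using AE_iff_null_sets[of U lebesgue] \<open>open U\<close> by (simp add: negligible_iff_null_sets)
  moreover have "x \<in> U" using assms(4) \<open>\<not> \<bar>f x\<bar> \<le> m\<close> by (simp add: U_def)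
  ultimately show False using open_not_negligible[OF \<open>open U\<close>] by auto
qed

lemma Linfty_norm_le:
  fixes f :: "'a::euclidean_space \<Rightarrow> real"
  assumes "open S" "continuous_on S f" "\<And>x. x \<in> S \<Longrightarrow> \<bar>f x\<bar> \<le> c"
  shows "Linfty_norm S f \<le> ereal c"
  unfolding Linfty_norm_def
proof (rule esssup_I)
  have "f \<in> borel_measurable (lebesgue_on S)"
    using assms(1,2) by (intro continuous_imp_measurable_on_sets_lebesgue) auto
  then show "(\<lambda>x. ereal \<bar>f x\<bar>) \<in> borel_measurable (lebesgue_on S)" by measurable
  show "AE x in lebesgue_on S. ereal \<bar>f x\<bar> \<le> ereal c"
    using assms(1,3) by (auto intro!: AE_I2)
qed

section \<open>The transformed equation and the bound on the gap\<close>

text \<open>The exponent k = (1 - \<gamma>) / 2 is tuned so that for w = u powr k all powers of u cancel from the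
g term, leaving g(u) itself, and the other terms share the factor 1 / w. Written in terms of k,
the exponents \<gamma> and (1 + \<gamma>) / 2 become 1 - 2 k and 1 - k.\<close>

lemma power_transform_equation:
  fixes u :: "real ^ 'n::finite \<Rightarrow> real"
  assumes S: "open S" "C2_on S u" "x \<in> S" and pos: "u x > 0" and k: "k > 0"
    and pde: "laplacian u x + u x powr (1 - 2 * k) - u x powr (1 - k) * G = 0"
  shows "\<exists>p q. (\<forall>i. has_second_order_at0 (\<lambda>t. u (x + t *\<^sub>R axis i 1) powr k) (p i) (q i)) \<and>
    (\<Sum>i\<in>UNIV. q i) = k * (G - (1 + (1 - k) / k\<^sup>2 * (\<Sum>i\<in>UNIV. (p i)\<^sup>2)) / u x powr k)"
proof -
  define U where "U = u x"
  have U: "U > 0" using pos by (simp add: U_def)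
  define d where "d i = partial_deriv i u x" for i
  define D where "D i = partial_deriv i (partial_deriv i u) x" for i
  define p where "p i = k * U powr (k - 1) * d i" for i
  define q where "q i = k * (k - 1) * U powr (k - 2) * (d i)\<^sup>2 + k * U powr (k - 1) * D i" for i
  have "has_second_order_at0 (\<lambda>t. u (x + t *\<^sub>R axis i 1) powr k) (p i) (q i)" for i
    using has_second_order_at0_powr[OF C2_on_second_order_along_axis[OF S, of i], of k] pos
    by (simp add: p_def q_def U_def d_def D_def)
  moreover have "(\<Sum>i\<in>UNIV. q i) = k * (G - (1 + (1 - k) / k\<^sup>2 * (\<Sum>i\<in>UNIV. (p i)\<^sup>2)) / U powr k)"
  proof -
    have "(\<Sum>i\<in>UNIV. q i) = k * (k - 1) * U powr (k - 2) * (\<Sum>i\<in>UNIV. (d i)\<^sup>2) + k * U powr (k - 1) * laplacian u x"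
      by (simp add: q_def sum.distrib sum_distrib_left laplacian_def D_def)
    moreover have "k * U powr (k - 1) * laplacian u x = k * (G - 1 / U powr k)"
    proof -
      have "laplacian u x = U powr (1 - k) * G - U powr (1 - 2 * k)" using pde by (simp add: U_def)
      moreover have "U powr (k - 1) * (U powr (1 - k) * G) = G"
        using U by (simp add: powr_add[symmetric] mult.assoc[symmetric])
      moreover have "U powr (k - 1) * U powr (1 - 2 * k) = 1 / U powr k"
        using U by (simp add: powr_add[symmetric] powr_minus_divide[symmetric])
      ultimately show ?thesis by (simp only: mult.assoc right_diff_distrib)
    qed
    moreover have "(\<Sum>i\<in>UNIV. (p i)\<^sup>2) = k\<^sup>2 * (U powr (k - 2) * U powr k) * (\<Sum>i\<in>UNIV. (d i)\<^sup>2)"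
    proof -
      have "(U powr (k - 1))\<^sup>2 = U powr (k - 2) * U powr k"
        using U by (simp add: power2_eq_square powr_add[symmetric])
      then show ?thesis by (simp add: p_def power_mult_distrib sum_distrib_left)
    qed
    moreover from this have "(1 - k) / k\<^sup>2 * (\<Sum>i\<in>UNIV. (p i)\<^sup>2) / U powr k
        = (1 - k) * U powr (k - 2) * (\<Sum>i\<in>UNIV. (d i)\<^sup>2)"
      using U k by simp
    ultimately show ?thesis by (simp only: add_divide_distrib) (simp add: algebra_simps)
  qed
  ultimately show ?thesis unfolding U_def by blast
qed

text \<open>The gap of w = u powr k, as a function of two points of the closure and a weight, attains its
maximum. If the weight is 0 or 1 the gap vanishes; if both points lie on the boundary it is at most 0,
as w vanishes there. A maximum with exactly one boundary point would be beaten by moving that point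
inward. There remains the interior case, covered by the second-order estimate. The bound on g
makes u superharmonic, as required for the growth at the boundary.\<close>

lemma gap_estimate:
  fixes u :: "real ^ 'n::finite \<Rightarrow> real"
  assumes S: "open S" "convex S" "bounded S" and ibc: "interior_ball_condition S"
    and u: "C2_on S u" "continuous_on (closure S) u"
    and bd: "\<And>x. x \<in> frontier S \<Longrightarrow> u x = 0" and pos: "\<And>x. x \<in> S \<Longrightarrow> u x > 0"
    and le_m: "\<And>x. x \<in> S \<Longrightarrow> u x \<le> m"
    and k: "0 < k" "k < 1" and delta: "\<delta> \<ge> 0"
    and pde: "\<And>x. x \<in> S \<Longrightarrow> laplacian u x + u x powr (1 - 2 * k) - u x powr (1 - k) * g (u x) = 0"
    and g_pos: "\<And>s. 0 < s \<Longrightarrow> s \<le> m \<Longrightarrow> 0 < g s"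
    and g_le: "\<And>s. 0 < s \<Longrightarrow> s \<le> m \<Longrightarrow> g s \<le> s powr (- k)"
    and g_mono: "\<And>s t. 0 < s \<Longrightarrow> s \<le> t \<Longrightarrow> t \<le> m \<Longrightarrow> g s \<le> g t"
    and g_HC: "\<And>s t l. 0 < s \<Longrightarrow> s \<le> m powr k \<Longrightarrow> 0 < t \<Longrightarrow> t \<le> m powr k \<Longrightarrow> 0 \<le> l \<Longrightarrow> l \<le> 1 \<Longrightarrow>
        HC (\<lambda>s. g (s powr (1 / k))) s t l \<le> \<delta>"
    and xyl: "x \<in> S" "y \<in> S" "0 \<le> l" "l \<le> 1"
  shows "convexity_gap (\<lambda>x. u x powr k) x y l \<le> (m powr k)\<^sup>2 * \<delta>"
proof -
  define w where "w x = u x powr k" for x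
  define h where "h s = g (s powr (1 / k))" for s
  have "m > 0" using pos[OF xyl(1)] le_m[OF xyl(1)] by simp
  have root: "0 < s powr (1 / k) \<and> s powr (1 / k) \<le> m" if "0 < s" "s \<le> m powr k" for s
    using powr_mono2[of "1 / k" s "m powr k"] that k \<open>m > 0\<close> by (simp add: powr_powr)
  have w_range: "0 < w z \<and> w z \<le> m powr k" if "z \<in> S" for z
    using pos[OF that] le_m[OF that] k by (simp add: w_def powr_mono2)
  have w_bd: "w z = 0" if "z \<in> closure S" "z \<notin> S" for z
    using bd[of z] that S(1) by (simp add: w_def frontier_def interior_open)
  have u_nonneg: "u z \<ge> 0" if "z \<in> closure S" for z
    using bd[of z] pos[of z] that S(1) by (cases "z \<in> S") (simp_all add: frontier_def interior_open)
  have w_nonneg: "w z \<ge> 0" for z by (simp add: w_def)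
  have w_cont: "continuous_on (closure S) w"
    unfolding w_def using k u_nonneg by (intro continuous_on_powr' u continuous_intros) auto
  have lap: "laplacian u z \<le> 0" if "z \<in> S" for z
  proof -
    have "u z powr (1 - k) * g (u z) \<le> u z powr (1 - k) * u z powr (- k)"
      using g_le[of "u z"] pos[OF that] le_m[OF that] by (intro mult_left_mono) auto
    also have "\<dots> = u z powr (1 - 2 * k)" using pos[OF that] by (simp add: powr_add[symmetric])
    finally show ?thesis using pde[OF that] by simp
  qed

  define T where "T = closure S \<times> closure S \<times> {0..1::real}"
  have "compact T" unfolding T_def using S(3) by (intro compact_Times) (auto simp: compact_closure)
  moreover have "T \<noteq> {}" using xyl(1) closure_subset by (fastforce simp: T_def)
  moreover have "continuous_on T (\<lambda>(a, b, c). convexity_gap w a b c)"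
  proof -
    have "(snd (snd z)) *\<^sub>R fst z + (1 - snd (snd z)) *\<^sub>R fst (snd z) \<in> closure S" if "z \<in> T" for z
      using that convex_closure[OF S(2)] by (intro convexD) (auto simp: T_def)
    then show ?thesis
      unfolding convexity_gap_def case_prod_beta'
      by (intro continuous_intros continuous_on_compose2[OF w_cont]) (auto simp: T_def)
  qed
  ultimately obtain x0 y0 l0 where T0: "(x0, y0, l0) \<in> T"
    and max': "\<And>z. z \<in> T \<Longrightarrow> (\<lambda>(a, b, c). convexity_gap w a b c) z \<le> convexity_gap w x0 y0 l0"
    using continuous_attains_sup[of T "\<lambda>(a, b, c). convexity_gap w a b c"] by fastforce
  have max: "convexity_gap w a b c \<le> convexity_gap w x0 y0 l0"
    if "a \<in> closure S" "b \<in> closure S" "0 \<le> c" "c \<le> 1" for a b c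
    using max'[of "(a, b, c)"] that by (simp add: T_def)
  have x0: "x0 \<in> closure S" and y0: "y0 \<in> closure S" and l0: "0 \<le> l0" "l0 \<le> 1"
    using T0 by (auto simp: T_def)
  have SC: "z \<in> closure S" if "z \<in> S" for z using that closure_subset by blast
  have rhs: "0 \<le> (m powr k)\<^sup>2 * \<delta>" using delta by simp
  have no_bd: "b \<notin> S" if a: "a \<in> closure S" "a \<notin> S" and c: "0 < c" "c < 1"
    and eq: "convexity_gap w a b c = convexity_gap w x0 y0 l0" for a b c
  proof
    assume b: "b \<in> S"
    have "a \<in> frontier S" using a S(1) by (simp add: frontier_def interior_open)
    then obtain z where "z \<in> S" "convexity_gap w a b c < convexity_gap w z b c"
      using gap_increases_from_boundary[OF S(1,2) u(1) lap u(2) pos bd ibc k _ b c]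
      unfolding w_def by blast
    with max[of z b c] SC b c eq show False by auto
  qed
  have "convexity_gap w x0 y0 l0 \<le> (m powr k)\<^sup>2 * \<delta>"
  proof -
    consider "l0 = 0 \<or> l0 = 1" | "0 < l0" "l0 < 1" "x0 \<in> S" "y0 \<in> S"
      | "0 < l0" "l0 < 1" "x0 \<notin> S" "y0 \<notin> S"
      | "0 < l0" "l0 < 1" "x0 \<notin> S" "y0 \<in> S" | "0 < l0" "l0 < 1" "x0 \<in> S" "y0 \<notin> S"
      using l0 by force
    then show ?thesis
    proof cases
      case 1
      then show ?thesis using rhs by (auto simp: convexity_gap_def)
    next
      case 2
      show ?thesis
      proof (rule interior_max_gap_le[OF S(1,2) 2(3,4,1,2), of w _ k "(1 - k) / k\<^sup>2" _ h])
        fix z assume z: "z \<in> S"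
        show "0 < w z \<and> w z \<le> m powr k" by (rule w_range[OF z])
        have "h (w z) = g (u z)" using pos[OF z] k by (simp add: h_def w_def powr_powr)
        then show "\<exists>p q. (\<forall>i. has_second_order_at0 (\<lambda>t. w (z + t *\<^sub>R axis i 1)) (p i) (q i)) \<and>
          (\<Sum>i\<in>UNIV. q i) = k * (h (w z) - (1 + (1 - k) / k\<^sup>2 * (\<Sum>i\<in>UNIV. (p i)\<^sup>2)) / w z)"
          using power_transform_equation[OF S(1) u(1) z pos[OF z] k(1) pde[OF z]]
          by (simp only: w_def)
      next
        fix s assume "0 < s" "s \<le> m powr k"
        then show "0 < h s" using root[of s] g_pos by (simp add: h_def)
      next
        fix s t assume "0 < s" "s \<le> t" "t \<le> m powr k"
        then show "h s \<le> h t"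
          using root[of s] root[of t] k unfolding h_def by (intro g_mono powr_mono2) auto
      next
        fix s t assume "0 < s" "s \<le> m powr k" "0 < t" "t \<le> m powr k"
        then show "HC h s t l0 \<le> \<delta>" using g_HC[of s t l0] l0 by (simp add: h_def[abs_def])
      next
        fix z z' assume "z \<in> S" "z' \<in> S"
        then show "convexity_gap w z z' l0 \<le> convexity_gap w x0 y0 l0" using max SC l0 by simp
      qed (use k delta in auto)
    next
      case 3
      then have "convexity_gap w x0 y0 l0 \<le> 0"
        using w_bd[OF x0] w_bd[OF y0] by (simp add: convexity_gap_def w_nonneg)
      with rhs show ?thesis by linarith
    next
      case 4
      then show ?thesis using no_bd[OF x0, of l0 y0] by auto
    next
      case 5
      then show ?thesis using no_bd[OF y0, of "1 - l0" x0] convexity_gap_swap[of w x0 y0 l0] by auto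
    qed
  qed
  with max[OF SC[OF xyl(1)] SC[OF xyl(2)] xyl(3,4)] show ?thesis
    unfolding w_def by (rule order_trans)
qed

lemma nondecreasing_from_derivative:
  fixes g g' :: "real \<Rightarrow> real"
  assumes der: "\<And>s. s \<in> {0<..m} \<Longrightarrow> (g has_real_derivative g' s) (at s within {0<..m})"
    and nonneg: "\<And>s. s \<in> {0<..m} \<Longrightarrow> g' s \<ge> 0" and st: "0 < s" "s \<le> t" "t \<le> m"
  shows "g s \<le> g t"
proof (rule DERIV_nonneg_imp_increasing_open[OF st(2)])
  show "continuous_on {s..t} g"
  proof (rule continuous_on_subset)
    show "continuous_on {0<..m} g" by (rule DERIV_continuous_on[OF der])
    show "{s..t} \<subseteq> {0<..m}" using st by auto
  qed
  fix r assume r: "s < r" "r < t"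
  have "r \<in> interior {0<..m}"
    by (rule interiorI[of "{s<..<t}"]) (use r st in auto)
  then have "at r within {0<..m} = at r" by (rule at_within_interior)
  moreover have "r \<in> {0<..m}" using r st by auto
  ultimately have "(g has_real_derivative g' r) (at r)" "g' r \<ge> 0" using der[of r] nonneg[of r] by auto
  then show "\<exists>y. (g has_real_derivative y) (at r) \<and> 0 \<le> y" by blast
qed

section \<open>Approximate concavity of the solution\<close>

theorem theorem4p3:
  fixes \<gamma> m :: real
  assumes "CARD('n::finite) \<ge> 2" and "0 \<le> \<gamma>" and "\<gamma> < 1"
  shows "\<exists>C>0. \<forall>(\<Omega> :: (real ^ 'n) set) (u :: real ^ 'n \<Rightarrow> real) (g :: real \<Rightarrow> real) (g' :: real \<Rightarrow> real) (\<delta> :: real).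
    open \<Omega> \<longrightarrow> connected \<Omega> \<longrightarrow> \<Omega> \<noteq> {} \<longrightarrow> bounded \<Omega> \<longrightarrow> convex \<Omega> \<longrightarrow> interior_ball_condition \<Omega> \<longrightarrow>
    C2_on \<Omega> u \<longrightarrow> continuous_on (closure \<Omega>) u \<longrightarrow>
    (\<forall>x\<in>\<Omega>. laplacian u x + u x powr \<gamma> - u x powr ((1 + \<gamma>) / 2) * g (u x) = 0) \<longrightarrow>
    (\<forall>x\<in>frontier \<Omega>. u x = 0) \<longrightarrow>
    (\<forall>x\<in>\<Omega>. u x > 0) \<longrightarrow>
    Linfty_norm \<Omega> u = ereal m \<longrightarrow>
    (\<forall>s\<in>{0<..m}. (g has_real_derivative g' s) (at s within {0<..m})) \<longrightarrow>
    continuous_on {0<..m} g' \<longrightarrow>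
    (\<forall>s\<in>{0<..m}. g s > 0) \<longrightarrow>
    (\<forall>s\<in>{0<..m}. g s \<le> s powr ((\<gamma> - 1) / 2)) \<longrightarrow>
    (\<forall>s\<in>{0<..m}. g' s \<ge> 0) \<longrightarrow>
    \<delta> \<ge> 0 \<longrightarrow>
    (\<forall>s\<^sub>1\<in>{0<..m powr ((1 - \<gamma>) / 2)}. \<forall>s\<^sub>3\<in>{0<..m powr ((1 - \<gamma>) / 2)}. \<forall>l\<in>{0..1}.
       HC (\<lambda>s. g (s powr (2 / (1 - \<gamma>)))) s\<^sub>1 s\<^sub>3 l \<le> \<delta>) \<longrightarrow>
    (\<exists>v. concave_on \<Omega> v \<and>
       Linfty_norm \<Omega> (\<lambda>x. u x powr ((1 - \<gamma>) / 2) - v x) \<le> ereal (C * \<delta>))"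
proof -
  define k where "k = (1 - \<gamma>) / 2"
  have k: "0 < k" "k < 1" using assms by (auto simp: k_def)
  have \<gamma>: "\<gamma> = 1 - 2 * k" by (simp add: k_def field_simps)
  have exponents: "(1 + (1 - 2 * k)) / 2 = 1 - k" "(1 - 2 * k - 1) / 2 = - k"
    "(1 - (1 - 2 * k)) / 2 = k" "2 / (1 - (1 - 2 * k)) = 1 / k"
    using k by (simp_all add: field_simps)
  \<comment> \<open>the summand 1 keeps C positive when m = 0\<close>
  define C where "C = (CARD('n) + 2) * (m powr k)\<^sup>2 + 1"
  have "C > 0" unfolding C_def by (simp add: add_nonneg_pos)
  have main: "\<exists>v. concave_on \<Omega> v \<and> Linfty_norm \<Omega> (\<lambda>x. u x powr k - v x) \<le> ereal (C * \<delta>)"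
    if S: "open \<Omega>" "bounded \<Omega>" "convex \<Omega>" "interior_ball_condition \<Omega>"
      and u: "C2_on \<Omega> u" "continuous_on (closure \<Omega>) u"
      and pde: "\<forall>x\<in>\<Omega>. laplacian u x + u x powr (1 - 2 * k) - u x powr (1 - k) * g (u x) = 0"
      and bd: "\<forall>x\<in>frontier \<Omega>. u x = 0" and pos: "\<forall>x\<in>\<Omega>. u x > 0"
      and m: "Linfty_norm \<Omega> u = ereal m"
      and der: "\<forall>s\<in>{0<..m}. (g has_real_derivative g' s) (at s within {0<..m})"
      and g: "\<forall>s\<in>{0<..m}. g s > 0" "\<forall>s\<in>{0<..m}. g s \<le> s powr (- k)" "\<forall>s\<in>{0<..m}. g' s \<ge> 0"
      and delta: "\<delta> \<ge> 0"
      and HC: "\<forall>s\<^sub>1\<in>{0<..m powr k}. \<forall>s\<^sub>3\<in>{0<..m powr k}. \<forall>l\<in>{0..1}.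
         HC (\<lambda>s. g (s powr (1 / k))) s\<^sub>1 s\<^sub>3 l \<le> \<delta>"
    for \<Omega> :: "(real ^ 'n) set" and u g g' \<delta>
  proof -
    have u_cont: "continuous_on \<Omega> u" by (rule continuous_on_subset[OF u(2) closure_subset])
    have le_m: "u x \<le> m" if "x \<in> \<Omega>" for x
      using continuous_le_Linfty_norm[OF S(1) u_cont m that] by simp
    have gap: "convexity_gap (\<lambda>x. u x powr k) x y l \<le> (m powr k)\<^sup>2 * \<delta>"
      if "x \<in> \<Omega>" "y \<in> \<Omega>" "0 \<le> l" "l \<le> 1" for x y l
    proof (rule gap_estimate[OF S(1,3,2,4) u _ _ le_m k delta _ _ _ _ _ that, where g = g])
      fix s t assume "0 < s" "s \<le> t" "t \<le> m"
      with der g(3) show "g s \<le> g t" by (intro nondecreasing_from_derivative[of m g g']) auto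
    qed (use bd pos pde g HC in auto)
    have nonneg: "(m powr k)\<^sup>2 * \<delta> \<ge> 0" using delta by simp
    obtain v where v: "concave_on \<Omega> v" "\<And>x. x \<in> \<Omega> \<Longrightarrow> u x powr k \<le> v x \<and>
        v x \<le> u x powr k + (DIM(real ^ 'n) + 1) * ((m powr k)\<^sup>2 * \<delta>)"
      using approx_concave_near_concave[OF S(3) nonneg gap] by blast
    have "continuous_on \<Omega> v"
      using convex_on_continuous[OF S(1), of "\<lambda>x. - v x"] v(1)
      by (simp add: concave_on_def) (use continuous_on_minus in fastforce)
    then have "continuous_on \<Omega> (\<lambda>x. u x powr k - v x)"
      using pos k by (intro continuous_intros continuous_on_powr' u_cont) (auto intro: less_imp_le)
    moreover have "\<bar>u x powr k - v x\<bar> \<le> C * \<delta>" if "x \<in> \<Omega>" for x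
    proof -
      have "\<bar>u x powr k - v x\<bar> \<le> (CARD('n) + 1) * ((m powr k)\<^sup>2 * \<delta>)" using v(2)[OF that] by simp
      also have "\<dots> \<le> C * \<delta>" using nonneg delta by (simp add: C_def algebra_simps)
      finally show ?thesis .
    qed
    ultimately have "Linfty_norm \<Omega> (\<lambda>x. u x powr k - v x) \<le> ereal (C * \<delta>)"
      by (rule Linfty_norm_le[OF S(1)])
    with v(1) show ?thesis by blast
  qed
  show ?thesis
    unfolding \<gamma> exponents
    by (intro exI[of _ C] conjI allI impI) (rule \<open>C > 0\<close>, rule main, assumption+)
qed

end
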